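(* Let $8\le D<n$ be positive integers, where $D$ is even. Fix any integer value $D/2\le\tau\le D-4$. There exists a class $\mathcal T$ of trees $T$ with size $\Theta(n)$, diameter $D$, and $\xi(T)\le\tau$, such that every leader election algorithm with advice working in time $\tau$ on the class $\mathcal T$ requires advice of size $\Omega(n/D)$. (The constants implied by $\Theta$ and $\Omega$ are absolute.)
   Context: Trees are finite, undirected and anonymous (nodes have no labels), and are port-numbered: at each node $v$ of degree $d$ the incident edges carry distinct port numbers from $\{0,\dots,d-1\}$; there is no relation between the two port numbers of an edge at its two endpoints. The size of a tree is its number of nodes. Leader election in $T$: every node $v$ must output a finite sequence $P(v)=(p_1,\dots,p_k)$ of nonnegative integers (possibly empty). Let $P^*(v)$ be the path starting at $v$ obtained by taking $p_i$ as the outgoing port at the $i$-th node of the path. All $P^*(v)$ must be simple paths in $T$ ending at one common node (the leader). View: $V_T(v,r)$ is the subtree of $T$ induced by all nodes at distance at most $r$ from $v$, rooted at $v$, with all port numbers at these nodes and with the degrees of all nodes at distance exactly $r$ from $v$ (views are identified up to root- and port-preserving isomorphism). Deterministic algorithm with advice (LOCAL model): an oracle knowing $T$ assigns to $T$ one binary string $A(T)$, given to all nodes at the start; the size of advice for $T$ is the length of $A(T)$. After each round $r\ge 0$, each node $v$ that has not yet halted decides, as a function of $V_T(v,r)$ and $A(T)$ only, whether to halt and what to output. The algorithm works in time $\tau$ on a class if it solves leader election in every tree of the class with all nodes halting in rounds at most $\tau$. It "requires advice of size $\Omega(L)$" on the class if $\max_{T\in\mathcal T}|A(T)|\in\Omega(L)$.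 All algorithms are deterministic. $\xi(T)$ is the minimum time in which leader election in $T$ is feasible when each node is given the entire port-numbered map of $T$ (without its own position marked), i.e., the smallest $\tau\ge 0$ for which there is a valid assignment of outputs in $T$ in which the output of each node $v$ depends only on $V_T(v,\tau)$. *)

theory Defs
  imports Complex_Main "HOL-Library.Extended_Nat" "HOL-Library.Extended_Real"
begin

section \<open>Port-numbered trees\<close>

text \<open>
  \<open>port T u w\<close> is the port number at \<open>u\<close> of the edge \<open>{u, w}\<close>; its values at other pairs
  are irrelevant. The elements of \<open>nodes T\<close> only serve to describe the tree: algorithms access a
  tree solely through views, which are taken up to isomorphism.
\<close>

record 'a pgraph =
  nodes :: "'a set"
  edges :: "'a set set"
  port :: "'a \<Rightarrow> 'a \<Rightarrow> nat"

definition neighbours :: "'a pgraph \<Rightarrow> 'a \<Rightarrow> 'a set" where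
  "neighbours T v = {w. {v, w} \<in> edges T}"

definition degree :: "'a pgraph \<Rightarrow> 'a \<Rightarrow> nat" where
  "degree T v = card (neighbours T v)"

definition walk :: "'a pgraph \<Rightarrow> 'a list \<Rightarrow> bool" where
  "walk T vs \<longleftrightarrow> vs \<noteq> [] \<and> set vs \<subseteq> nodes T \<and>
     (\<forall>i. Suc i < length vs \<longrightarrow> {vs ! i, vs ! Suc i} \<in> edges T)"

definition cycle :: "'a pgraph \<Rightarrow> 'a list \<Rightarrow> bool" where
  "cycle T vs \<longleftrightarrow> walk T vs \<and> distinct vs \<and> 3 \<le> length vs \<and> {last vs, hd vs} \<in> edges T"

definition pn_tree :: "'a pgraph \<Rightarrow> bool" where
  "pn_tree T \<longleftrightarrow>
     finite (nodes T) \<and> nodes T \<noteq> {} \<and>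
     (\<forall>e\<in>edges T. e \<subseteq> nodes T \<and> card e = 2) \<and>
     (\<forall>u\<in>nodes T. \<forall>v\<in>nodes T. \<exists>vs. walk T vs \<and> hd vs = u \<and> last vs = v) \<and>
     (\<nexists>vs. cycle T vs) \<and>
     (\<forall>v\<in>nodes T. bij_betw (port T v) (neighbours T v) {..<degree T v})"

definition gdist :: "'a pgraph \<Rightarrow> 'a \<Rightarrow> 'a \<Rightarrow> nat" where
  "gdist T u v = (LEAST k. \<exists>vs. walk T vs \<and> hd vs = u \<and> last vs = v \<and> length vs = Suc k)"

definition diam :: "'a pgraph \<Rightarrow> nat" where
  "diam T = Max {gdist T u v | u v. u \<in> nodes T \<and> v \<in> nodes T}"


section \<open>Leader election\<close>

definition follows_ports :: "'a pgraph \<Rightarrow> 'a list \<Rightarrow> nat list \<Rightarrow> bool" where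
  "follows_ports T vs ps \<longleftrightarrow> walk T vs \<and> length vs = Suc (length ps) \<and>
     (\<forall>i<length ps. port T (vs ! i) (vs ! Suc i) = ps ! i)"

definition leader_election :: "'a pgraph \<Rightarrow> ('a \<Rightarrow> nat list) \<Rightarrow> bool" where
  "leader_election T P \<longleftrightarrow>
     (\<exists>l\<in>nodes T. \<forall>v\<in>nodes T. \<exists>vs.
        follows_ports T vs (P v) \<and> hd vs = v \<and> distinct vs \<and> last vs = l)"


section \<open>Views\<close>

text \<open>
  The field \<open>bdeg\<close> records the degree in the whole tree of the nodes at distance exactly \<open>r\<close> from
  the root, and is \<open>None\<close> at all other nodes.
\<close>

record 'a rooted_view = "'a pgraph" +
  vroot :: 'a
  bdeg :: "'a \<Rightarrow> nat option"

definition local_view :: "'a pgraph \<Rightarrow> 'a \<Rightarrow> nat \<Rightarrow> 'a rooted_view" where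
  "local_view T v r =
     (let B = {u \<in> nodes T. gdist T v u \<le> r} in
      \<lparr> nodes = B, edges = {e \<in> edges T. e \<subseteq> B}, port = port T, vroot = v,
        bdeg = (\<lambda>u. if u \<in> B \<and> gdist T v u = r then Some (degree T u) else None) \<rparr>)"

definition view_iso :: "'a rooted_view \<Rightarrow> 'a rooted_view \<Rightarrow> bool" where
  "view_iso W W' \<longleftrightarrow>
     (\<exists>f. bij_betw f (nodes W) (nodes W') \<and> f (vroot W) = vroot W' \<and>
        (\<forall>u\<in>nodes W. \<forall>w\<in>nodes W.
           ({u, w} \<in> edges W \<longleftrightarrow> {f u, f w} \<in> edges W') \<and>
           ({u, w} \<in> edges W \<longrightarrow> port W u w = port W' (f u) (f w))) \<and>
        (\<forall>u\<in>nodes W. bdeg W u = bdeg W' (f u)))"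

text \<open>
  \<open>view T v r\<close> is the isomorphism class of the concrete view, so that \<open>view T v r = view T' v' r'\<close>
  says that the two views are isomorphic, and a function of views cannot depend on node names.
\<close>

definition view :: "'a pgraph \<Rightarrow> 'a \<Rightarrow> nat \<Rightarrow> 'a rooted_view set" where
  "view T v r = {W. view_iso (local_view T v r) W}"

definition feasible_in :: "'a pgraph \<Rightarrow> nat \<Rightarrow> bool" where
  "feasible_in T t \<longleftrightarrow>
     (\<exists>P. leader_election T P \<and>
        (\<forall>u\<in>nodes T. \<forall>v\<in>nodes T. view T u t = view T v t \<longrightarrow> P u = P v))"

text \<open>\<open>xi T = \<infinity>\<close> if leader election is infeasible in \<open>T\<close>, whatever the time.\<close>

definition xi :: "'a pgraph \<Rightarrow> enat" where
  "xi T = Inf {enat t | t. feasible_in T t}"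


section \<open>Algorithms with advice\<close>

text \<open>
  An algorithm maps the current view and the advice to \<open>None\<close> (do not halt in this round) or to
  \<open>Some p\<close> (halt with output \<open>p\<close>).  A node halts in the first round in which the answer is not
  \<open>None\<close>; later answers are never consulted.
\<close>

type_synonym 'a algorithm = "'a rooted_view set \<Rightarrow> bool list \<Rightarrow> nat list option"

type_synonym 'a adviser = "'a pgraph \<Rightarrow> bool list"

definition halt_round :: "'a algorithm \<Rightarrow> bool list \<Rightarrow> 'a pgraph \<Rightarrow> 'a \<Rightarrow> nat" where
  "halt_round alg s T v = (LEAST r. alg (view T v r) s \<noteq> None)"

definition node_output :: "'a algorithm \<Rightarrow> bool list \<Rightarrow> 'a pgraph \<Rightarrow> 'a \<Rightarrow> nat list" where
  "node_output alg s T v = the (alg (view T v (halt_round alg s T v)) s)"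

definition works_in_time :: "'a algorithm \<Rightarrow> 'a adviser \<Rightarrow> nat \<Rightarrow> 'a pgraph set \<Rightarrow> bool" where
  "works_in_time alg A t \<T> \<longleftrightarrow>
     (\<forall>T\<in>\<T>. (\<forall>v\<in>nodes T. \<exists>r\<le>t. alg (view T v r) (A T) \<noteq> None) \<and>
             leader_election T (node_output alg (A T) T))"

text \<open>
  The maximum advice length over the class; as lengths are natural numbers, the supremum is
  attained whenever it is finite and the class is nonempty (it is \<open>- \<infinity>\<close> for the empty class).
\<close>

definition advice_size :: "'a adviser \<Rightarrow> 'a pgraph set \<Rightarrow> ereal" where
  "advice_size A \<T> = (SUP T\<in>\<T>. ereal (real (length (A T))))"

end

theory Submission
  imports Defs "HOL-Library.Nat_Bijection"
begin

text \<open>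
  Let \<open>h = D div 2\<close>. Take two adjacent centres \<open>c\<^sub>0\<close> and \<open>c\<^sub>1\<close>, each carrying \<open>k = \<Theta>(n / D)\<close> paths
  (branches) of length \<open>h - 2\<close> to \<open>h\<close>, with the same ports \<open>0, \<dots>, k\<close> at both centres. Branch \<open>0\<close> has
  length \<open>h\<close> at \<open>c\<^sub>0\<close> and \<open>h - 1\<close> at \<open>c\<^sub>1\<close>. For every other \<open>i\<close>, the branches \<open>i\<close> at the two centres have
  lengths \<open>h - 1\<close> and \<open>h - 2\<close>, and a bit decides which of them is the longer one. With the map, a
  node recognizes its position at distance \<open>h\<close> from the length of its own branch.

  The end of the longer branch \<open>i\<close> sees within distance \<open>2 * h - 4 = D - 4\<close> no other branch end, so it
  cannot tell to which centre it is attached. Its output tells whether the leader is on its own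
  side of the edge \<open>c\<^sub>0c\<^sub>1\<close>, so flipping bit \<open>i\<close> with the same advice moves the leader to the other
  side. The end of the branch of length \<open>h\<close>, however, always lies on the side of \<open>c\<^sub>0\<close>, and its output
  depends on the advice alone. Hence the \<open>2 ^ (k - 1)\<close> choices of the bits need different advice.
\<close>

section \<open>Distances and acyclicity in graphs\<close>

text \<open>Following the neighbours given by \<open>closer\<close> yields a walk with
  \<open>\<delta> u v\<close> edges, and by \<open>lip\<close> no walk between the two nodes has
  fewer.\<close>

lemma gdist_eqI:
  assumes self: "\<And>v. v \<in> nodes T \<Longrightarrow> \<delta> v v = 0"
    and zero: "\<And>u v. u \<in> nodes T \<Longrightarrow> v \<in> nodes T \<Longrightarrow> \<delta> u v = 0 \<Longrightarrow> u = v"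
    and lip: "\<And>u w v. {u, w} \<in> edges T \<Longrightarrow> v \<in> nodes T \<Longrightarrow> \<delta> u v \<le> Suc (\<delta> w v)"
    and closer: "\<And>u v. u \<in> nodes T \<Longrightarrow> v \<in> nodes T \<Longrightarrow> \<delta> u v \<noteq> 0 \<Longrightarrow>
       \<exists>w\<in>nodes T. {u, w} \<in> edges T \<and> \<delta> u v = Suc (\<delta> w v)"
    and u: "u \<in> nodes T" and v: "v \<in> nodes T"
  shows "gdist T u v = \<delta> u v" and "\<exists>vs. walk T vs \<and> hd vs = u \<and> last vs = v"
proof -
  have ex: "\<exists>vs. walk T vs \<and> hd vs = u \<and> last vs = v \<and> length vs = Suc (\<delta> u v)"
    using u
  proof (induction "\<delta> u v" arbitrary: u)
    case 0
    then have "u = v" using zero v by metis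
    then show ?case using v self by (intro exI[of _ "[v]"]) (simp add: walk_def)
  next
    case (Suc m)
    then obtain w where w: "w \<in> nodes T" "{u, w} \<in> edges T" "\<delta> u v = Suc (\<delta> w v)"
      using closer[of u v] v by (metis nat.distinct(1))
    with Suc have "\<exists>vs. walk T vs \<and> hd vs = w \<and> last vs = v \<and> length vs = Suc (\<delta> w v)"
      by (metis nat.inject)
    then obtain vs where vs: "walk T vs" "hd vs = w" "last vs = v" "length vs = Suc (\<delta> w v)"
      by blast
    then have "walk T (u # vs)"
      using w Suc.prems by (auto simp: walk_def nth_Cons hd_conv_nth split: nat.splits)
    then show ?case using vs w by (intro exI[of _ "u # vs"]) auto
  qed
  then show "\<exists>vs. walk T vs \<and> hd vs = u \<and> last vs = v" by blast
  have low: "\<delta> (hd vs) (last vs) < length vs" if "walk T vs" for vs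
    using that
  proof (induction vs rule: induct_list012)
    case 1
    then show ?case by (simp add: walk_def)
  next
    case (2 x)
    then show ?case using self by (simp add: walk_def)
  next
    case (3 x y zs)
    from 3(3) have "walk T (y # zs)" "{x, y} \<in> edges T" "last (y # zs) \<in> nodes T"
      by (auto simp: walk_def)
    then show ?case using 3(2) lip[of x y "last (y # zs)"] by auto
  qed
  show "gdist T u v = \<delta> u v"
    unfolding gdist_def
    by (rule Least_equality) (use ex low in \<open>auto dest!: low\<close>)
qed

text \<open>A node of maximal rank on a cycle would have two neighbours of smaller rank.\<close>

lemma acyclic_by_rank:
  fixes rank :: "'a \<Rightarrow> nat"
  assumes neq: "\<And>u w. {u, w} \<in> edges T \<Longrightarrow> rank u \<noteq> rank w"
    and uniq: "\<And>v u w. {v, u} \<in> edges T \<Longrightarrow> {v, w} \<in> edges T \<Longrightarrow>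
       rank u < rank v \<Longrightarrow> rank w < rank v \<Longrightarrow> u = w"
  shows "\<not> cycle T vs"
proof
  assume c: "cycle T vs"
  define n where "n = length vs"
  have n: "3 \<le> n" and d: "distinct vs"
    using c by (auto simp: cycle_def n_def)
  have e: "{vs ! i, vs ! (Suc i mod n)} \<in> edges T" if "i < n" for i
  proof (cases "Suc i = n")
    case True
    moreover have "vs \<noteq> []"
      using n n_def by auto
    ultimately have "last vs = vs ! i" "hd vs = vs ! 0"
      by (metis diff_Suc_1 last_conv_nth n_def, simp add: hd_conv_nth)
    then show ?thesis using c True by (simp add: cycle_def)
  next
    case False
    then show ?thesis using c that by (simp add: cycle_def walk_def n_def)
  qed
  have "finite (rank ` set vs)" "rank ` set vs \<noteq> {}" using n n_def by auto
  from Max_in[OF this] obtain m where m: "m < n" "rank (vs ! m) = Max (rank ` set vs)"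
    by (metis imageE in_set_conv_nth n_def)
  have top: "rank (vs ! i) \<le> rank (vs ! m)" if "i < n" for i
    using that m by (simp add: n_def)
  define p where "p = (if m = 0 then n - 1 else m - 1)"
  have p: "p < n" "Suc p mod n = m" "p \<noteq> Suc m mod n"
    using m n by (auto simp: p_def mod_Suc)
  have s: "Suc m mod n < n" using n by simp
  have mp: "{vs ! m, vs ! p} \<in> edges T" using e[OF p(1)] p(2) by (simp add: insert_commute)
  have ms: "{vs ! m, vs ! (Suc m mod n)} \<in> edges T" using e m by simp
  have "rank (vs ! p) < rank (vs ! m)" "rank (vs ! (Suc m mod n)) < rank (vs ! m)"
    using neq[OF mp] neq[OF ms] top[OF p(1)] top[OF s] by simp_all
  then have "vs ! p = vs ! (Suc m mod n)" using uniq[OF mp ms] by blast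
  then show False using p s d by (simp add: nth_eq_iff_index_eq n_def)
qed

section \<open>Views and the outputs computed from them\<close>

lemma view_iso_refl: "view_iso W W"
  unfolding view_iso_def by (rule exI[of _ id]) auto

lemma view_iso_sym:
  assumes "view_iso V W" and r: "vroot V \<in> nodes V"
  shows "view_iso W V"
proof -
  obtain f where f: "bij_betw f (nodes V) (nodes W)" "f (vroot V) = vroot W"
    and e: "\<forall>u\<in>nodes V. \<forall>w\<in>nodes V.
           ({u, w} \<in> edges V \<longleftrightarrow> {f u, f w} \<in> edges W) \<and>
           ({u, w} \<in> edges V \<longrightarrow> port V u w = port W (f u) (f w))"
    and b: "\<forall>u\<in>nodes V. bdeg V u = bdeg W (f u)"
    using assms unfolding view_iso_def by blast
  define g where "g = inv_into (nodes V) f"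
  have gf: "g (f u) = u" if "u \<in> nodes V" for u
    using f that by (simp add: g_def bij_betw_def)
  have W: "nodes W = f ` nodes V" using f by (simp add: bij_betw_def)
  have "bij_betw g (nodes W) (nodes V)" using f by (simp add: g_def bij_betw_inv_into)
  moreover have "g (vroot W) = vroot V" using f gf r by metis
  ultimately show ?thesis unfolding view_iso_def
    by (intro exI[of _ g]) (auto simp: W gf e b)
qed

lemma view_iso_trans:
  assumes "view_iso U V" "view_iso V W"
  shows "view_iso U W"
proof -
  obtain f where f: "bij_betw f (nodes U) (nodes V)" "f (vroot U) = vroot V"
    and fe: "\<forall>u\<in>nodes U. \<forall>w\<in>nodes U.
           ({u, w} \<in> edges U \<longleftrightarrow> {f u, f w} \<in> edges V) \<and>
           ({u, w} \<in> edges U \<longrightarrow> port U u w = port V (f u) (f w))"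
    and fb: "\<forall>u\<in>nodes U. bdeg U u = bdeg V (f u)"
    using assms(1) unfolding view_iso_def by blast
  obtain g where g: "bij_betw g (nodes V) (nodes W)" "g (vroot V) = vroot W"
    and ge: "\<forall>u\<in>nodes V. \<forall>w\<in>nodes V.
           ({u, w} \<in> edges V \<longleftrightarrow> {g u, g w} \<in> edges W) \<and>
           ({u, w} \<in> edges V \<longrightarrow> port V u w = port W (g u) (g w))"
    and gb: "\<forall>u\<in>nodes V. bdeg V u = bdeg W (g u)"
    using assms(2) unfolding view_iso_def by blast
  have m: "f u \<in> nodes V" if "u \<in> nodes U" for u using f that by (auto simp: bij_betw_def)
  show ?thesis unfolding view_iso_def
    by (rule exI[of _ "g \<circ> f"])
      (use f fe fb g ge gb m in \<open>auto intro: bij_betw_trans\<close>)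
qed

text \<open>Isomorphism acts as an equivalence here. Symmetry needs the root to lie in the view,
  which holds because a node has distance \<open>0\<close> to itself.\<close>

lemma view_eq_iff:
  assumes "v \<in> nodes T"
  shows "view T v r = view T' v' r \<longleftrightarrow> view_iso (local_view T v r) (local_view T' v' r)"
proof
  assume "view T v r = view T' v' r"
  moreover have "local_view T' v' r \<in> view T' v' r" by (simp add: view_def view_iso_refl)
  ultimately show "view_iso (local_view T v r) (local_view T' v' r)" by (auto simp: view_def)
next
  assume iso: "view_iso (local_view T v r) (local_view T' v' r)"
  have "gdist T v v = 0"
    unfolding gdist_def
    by (rule Least_eq_0) (use assms in \<open>auto intro!: exI[of _ "[v]"] simp: walk_def\<close>)
  then have "vroot (local_view T v r) \<in> nodes (local_view T v r)"
    using assms by (simp add: local_view_def Let_def)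
  then show "view T v r = view T' v' r"
    unfolding view_def using iso view_iso_sym view_iso_trans by blast
qed

text \<open>The first round with an answer at \<open>v\<close> lies within time \<open>t\<close>,
  where the views agree, so it is also the first such round at \<open>v'\<close>.\<close>

lemma node_output_cong:
  assumes "\<exists>r\<le>t. alg (view T v r) s \<noteq> None"
    and "\<And>r. r \<le> t \<Longrightarrow> view T v r = view T' v' r"
  shows "node_output alg s T v = node_output alg s T' v'"
proof -
  obtain r where r: "r \<le> t" "alg (view T v r) s \<noteq> None" using assms(1) by blast
  define m where "m = halt_round alg s T v"
  have m: "alg (view T v m) s \<noteq> None" "m \<le> r"
    unfolding m_def halt_round_def by (rule LeastI Least_le, rule r)+
  have below: "alg (view T v q) s = None" if "q < m" for q
    using not_less_Least[of q] that unfolding m_def halt_round_def by blast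
  have "halt_round alg s T' v' = m"
    unfolding halt_round_def
  proof (rule Least_equality)
    show "alg (view T' v' m) s \<noteq> None" using m r assms(2) by (metis le_trans)
  next
    fix q assume q: "alg (view T' v' q) s \<noteq> None"
    show "m \<le> q"
    proof (rule ccontr)
      assume "\<not> m \<le> q"
      then show False using below[of q] q assms(2)[of q] m r by simp
    qed
  qed
  then show ?thesis using assms(2)[of m] m r by (simp add: node_output_def m_def[symmetric])
qed

section \<open>Counting advice strings\<close>

text \<open>Fewer than \<open>2 ^ m\<close> binary strings have length below
  \<open>m\<close>.\<close>

lemma advice_size_lower:
  assumes fin: "finite \<T>" and inj: "inj_on A \<T>" and card: "2 ^ m \<le> card \<T>"
  shows "ereal (real m) \<le> advice_size A \<T>"
proof -
  have "\<exists>T\<in>\<T>. m \<le> length (A T)"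
  proof (rule ccontr)
    assume "\<not> ?thesis"
    then have sub: "A ` \<T> \<subseteq> (\<Union>l<m. {xs. set xs \<subseteq> UNIV \<and> length xs = l})" by force
    have "card \<T> = card (A ` \<T>)" using inj by (simp add: card_image)
    also have "\<dots> \<le> card (\<Union>l<m. {xs :: bool list. set xs \<subseteq> UNIV \<and> length xs = l})"
      by (rule card_mono[OF _ sub]) (auto intro!: finite_lists_length_eq[of UNIV, simplified])
    also have "\<dots> \<le> (\<Sum>l<m. card {xs :: bool list. set xs \<subseteq> UNIV \<and> length xs = l})"
      by (rule card_UN_le) simp
    also have "\<dots> = (\<Sum>l<m. 2 ^ l)"
      by (rule sum.cong) (use card_lists_length_eq[of "UNIV :: bool set"] in auto)
    also have "\<dots> < 2 ^ m" by (induction m) auto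
    finally show False using card by simp
  qed
  then show ?thesis
    unfolding advice_size_def by (auto intro: SUP_upper2)
qed

section \<open>Twin trees: nodes, distances and ports\<close>

text \<open>The node at distance \<open>d\<close> from the centre of side \<open>s\<close> along
  branch \<open>i\<close>. All trees draw their nodes from this supply, so positions can be compared
  between trees.\<close>

definition nd :: "nat \<Rightarrow> nat \<Rightarrow> nat \<Rightarrow> nat" where
  "nd s i d = prod_encode (s, prod_encode (i, d))"

definition side :: "nat \<Rightarrow> nat" where
  "side v = fst (prod_decode v)"

definition branch :: "nat \<Rightarrow> nat" where
  "branch v = fst (prod_decode (snd (prod_decode v)))"

definition depth :: "nat \<Rightarrow> nat" where
  "depth v = snd (prod_decode (snd (prod_decode v)))"

lemma nd_simps [simp]: "side (nd s i d) = s" "branch (nd s i d) = i" "depth (nd s i d) = d"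
  by (simp_all add: nd_def side_def branch_def depth_def)

lemma nd_collapse [simp]: "nd (side v) (branch v) (depth v) = v"
  by (simp add: nd_def side_def branch_def depth_def)

lemma node_eqI: "side u = side v \<Longrightarrow> branch u = branch v \<Longrightarrow> depth u = depth v \<Longrightarrow> u = v"
  by (metis nd_collapse)

lemma nd_eq_iff: "nd s i d = v \<longleftrightarrow> s = side v \<and> i = branch v \<and> d = depth v"
  "v = nd s i d \<longleftrightarrow> side v = s \<and> branch v = i \<and> depth v = d"
  by auto

text \<open>The distance in the trees below, as \<open>gdist_twin\<close> confirms. The sum of the
  two truncated differences is the absolute difference of the depths.\<close>

definition tdist :: "nat \<Rightarrow> nat \<Rightarrow> nat" where
  "tdist u v =
     (if side u \<noteq> side v then depth u + depth v + 1
      else if branch u = branch v then (depth u - depth v) + (depth v - depth u)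
      else depth u + depth v)"

text \<open>A centre is kept under branch \<open>0\<close> alone, as otherwise it would occur once
  for each branch.\<close>

definition tnodes :: "nat \<Rightarrow> (nat \<Rightarrow> nat \<Rightarrow> nat) \<Rightarrow> nat set" where
  "tnodes k L = {v. side v < 2 \<and> branch v < k \<and> depth v \<le> L (side v) (branch v) \<and>
     (depth v = 0 \<longrightarrow> branch v = 0)}"

text \<open>
  Two adjacent centres \<open>nd 0 0 0\<close> and \<open>nd 1 0 0\<close>, the port between them being \<open>k\<close> on both sides.
  For every \<open>i < k\<close>, port \<open>i\<close> of the centre of side \<open>s\<close> leads into a path with \<open>L s i\<close> nodes
  \<open>nd s i 1, \<dots>, nd s i (L s i)\<close>, on which port \<open>0\<close> points to the centre.
\<close>

definition twin :: "nat \<Rightarrow> (nat \<Rightarrow> nat \<Rightarrow> nat) \<Rightarrow> nat pgraph" where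
  "twin k L = \<lparr>nodes = tnodes k L,
     edges = {{u, w} | u w. u \<in> tnodes k L \<and> w \<in> tnodes k L \<and> tdist u w = 1},
     port = (\<lambda>u w. if depth u = 0 then if side w = side u then branch w else k
                   else if depth w < depth u then 0 else 1)\<rparr>"

text \<open>The degree in \<open>twin\<close>, as \<open>degree_twin\<close> confirms: a centre has
  \<open>k\<close> branches and the edge to the other centre.\<close>

definition tdeg :: "nat \<Rightarrow> (nat \<Rightarrow> nat \<Rightarrow> nat) \<Rightarrow> nat \<Rightarrow> nat" where
  "tdeg k L v = (if depth v = 0 then Suc k else if depth v = L (side v) (branch v) then 1 else 2)"

lemma tdist_commute: "tdist u v = tdist v u"
  by (simp add: tdist_def)

lemma twin_edge_iff:
  "{u, w} \<in> edges (twin k L) \<longleftrightarrow> u \<in> tnodes k L \<and> w \<in> tnodes k L \<and> tdist u w = 1"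
  by (auto simp: twin_def doubleton_eq_iff tdist_commute)

lemma nodes_twin [simp]: "nodes (twin k L) = tnodes k L"
  by (simp add: twin_def)

lemma port_twin:
  "port (twin k L) u w = (if depth u = 0 then if side w = side u then branch w else k
                   else if depth w < depth u then 0 else 1)"
  by (simp add: twin_def)

lemma tdist_triangle: "tdist u v \<le> tdist u w + tdist w v"
  unfolding tdist_def
  by (cases "side u = side v"; cases "side w = side v";
      cases "branch u = branch v"; cases "branch w = branch v";
      cases "side u = side w"; cases "branch u = branch w"; simp)

lemma tdist_eq_0: "u \<in> tnodes k L \<Longrightarrow> v \<in> tnodes k L \<Longrightarrow> tdist u v = 0 \<Longrightarrow> u = v"
  by (rule node_eqI) (auto simp: tdist_def tnodes_def split: if_splits)

text \<open>The inverse of the port numbering: the neighbour of \<open>v\<close> behind port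
  \<open>p\<close>.\<close>

definition nbr :: "nat \<Rightarrow> nat \<Rightarrow> nat \<Rightarrow> nat" where
  "nbr k v p =
     (if depth v = 0 then if p = k then nd (1 - side v) 0 0 else nd (side v) p 1
      else if p = 0 then nd (side v) (if depth v = 1 then 0 else branch v) (depth v - 1)
      else nd (side v) (branch v) (depth v + 1))"

text \<open>Both directions of the inverse pair \<open>nbr\<close> and \<open>port\<close>, checked
  case by case. The bound on \<open>L\<close> provides the first node of every branch.\<close>

lemma
  assumes L: "\<And>s i. s < 2 \<Longrightarrow> i < k \<Longrightarrow> 1 \<le> L s i" and k: "2 \<le> k"
    and v: "v \<in> tnodes k L"
  shows nbr_edge: "p < tdeg k L v \<Longrightarrow> {v, nbr k v p} \<in> edges (twin k L)"
    and port_nbr: "p < tdeg k L v \<Longrightarrow> port (twin k L) v (nbr k v p) = p"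
    and port_less: "{v, w} \<in> edges (twin k L) \<Longrightarrow> port (twin k L) v w < tdeg k L v"
    and nbr_port: "{v, w} \<in> edges (twin k L) \<Longrightarrow> nbr k v (port (twin k L) v w) = w"
proof -
  have c: "branch v = 0" if "depth v = 0" using v that by (simp add: tnodes_def)
  have sv: "side v = 0 \<or> side v = 1" using v by (auto simp: tnodes_def)
  show "{v, nbr k v p} \<in> edges (twin k L)" if "p < tdeg k L v"
    using that v k L[of "side v" p] L[of 0 0] L[of 1 0] sv
    by (auto simp: twin_edge_iff nbr_def tdeg_def tnodes_def tdist_def split: if_splits)
  show "port (twin k L) v (nbr k v p) = p" if "p < tdeg k L v"
    using that v sv by (auto simp: port_twin nbr_def tdeg_def tnodes_def split: if_splits)
  show "port (twin k L) v w < tdeg k L v" if "{v, w} \<in> edges (twin k L)"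
    using that v sv
    by (auto simp: twin_edge_iff port_twin tdeg_def tnodes_def tdist_def split: if_splits)
  show "nbr k v (port (twin k L) v w) = w" if "{v, w} \<in> edges (twin k L)"
    using that v sv
    by (auto simp: twin_edge_iff port_twin nbr_def nd_eq_iff tnodes_def tdist_def
        split: if_splits)
qed

locale twin_tree =
  fixes k :: nat and L :: "nat \<Rightarrow> nat \<Rightarrow> nat"
  assumes k: "2 \<le> k" and L: "\<And>s i. s < 2 \<Longrightarrow> i < k \<Longrightarrow> 1 \<le> L s i"
begin

abbreviation "T \<equiv> twin k L"
abbreviation "V \<equiv> tnodes k L"

lemma centre_in: "s < 2 \<Longrightarrow> nd s 0 0 \<in> V"
  using k by (simp add: tnodes_def)

lemma bij_port: "v \<in> V \<Longrightarrow> bij_betw (port T v) (neighbours T v) {..<tdeg k L v}"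
  using k L by (intro bij_betw_byWitness[where f' = "nbr k v"])
    (auto simp: neighbours_def nbr_port port_nbr intro: nbr_edge port_less)

lemma degree_twin: "v \<in> V \<Longrightarrow> degree T v = tdeg k L v"
  using bij_betw_same_card[OF bij_port] by (simp add: degree_def)

lemma closer:
  assumes "u \<in> V" "v \<in> V" "tdist u v \<noteq> 0"
  shows "\<exists>w\<in>V. {u, w} \<in> edges T \<and> tdist u v = Suc (tdist w v)"
proof -
  \<comment> \<open>The port towards \<open>v\<close>: at a centre into the branch of
    \<open>v\<close> or across, on a branch outwards only if \<open>v\<close> lies further out on
    it.\<close>
  define p where "p = (if depth u = 0 then if side u = side v then branch v else k
    else if side u = side v \<and> branch u = branch v \<and> depth u < depth v then 1 else 0)"
  have p: "p < tdeg k L u" using assms by (auto simp: p_def tdeg_def tnodes_def)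
  have e: "{u, nbr k u p} \<in> edges T" using assms p k L by (intro nbr_edge) auto
  moreover have "tdist u v = Suc (tdist (nbr k u p) v)"
  proof (cases "depth u = 0")
    case True
    then have "branch u = 0" "side u < 2" "side v < 2" "side u = side v \<Longrightarrow> depth v \<noteq> 0"
      using assms by (auto simp: tnodes_def tdist_def)
    then show ?thesis
      using True assms(2) by (cases "side u = side v"; cases "branch v = 0")
        (auto simp: p_def nbr_def tdist_def tnodes_def)
  next
    case False
    then show ?thesis
      using assms(3) by (cases "side u = side v"; cases "branch u = branch v")
        (auto simp: p_def nbr_def tdist_def)
  qed
  ultimately show ?thesis by (auto simp: twin_edge_iff)
qed

lemma finite_nodes: "finite V"
proof -
  define m where "m = Max (case_prod L ` ({..<2} \<times> {..<k}))"
  have "depth v \<le> m" if "v \<in> V" for v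
  proof -
    have "L (side v) (branch v) \<le> m"
      unfolding m_def using that by (intro Max_ge) (auto simp: tnodes_def image_iff)
    then show ?thesis using that by (simp add: tnodes_def)
  qed
  then have "V \<subseteq> (\<lambda>(s, i, d). nd s i d) ` ({..<2} \<times> {..<k} \<times> {..m})"
    by (auto simp: tnodes_def image_iff nd_eq_iff)
  then show ?thesis by (rule finite_subset) simp
qed

lemma
  assumes "u \<in> V" "v \<in> V"
  shows gdist_twin: "gdist T u v = tdist u v"
    and connected: "\<exists>vs. walk T vs \<and> hd vs = u \<and> last vs = v"
proof -
  have lip: "tdist u v \<le> Suc (tdist w v)" if "{u, w} \<in> edges T" "v \<in> V" for u w v
    using that tdist_triangle[of u v w] by (simp add: twin_edge_iff)
  note * = gdist_eqI[of T tdist u v, OF _ _ lip]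
  show "gdist T u v = tdist u v"
    by (rule *(1)) (use assms closer tdist_eq_0 in \<open>auto simp: tdist_def[of v v for v]\<close>)
  show "\<exists>vs. walk T vs \<and> hd vs = u \<and> last vs = v"
    by (rule *(2)) (use assms closer tdist_eq_0 in \<open>auto simp: tdist_def[of v v for v]\<close>)
qed

lemma pn_tree_twin: "pn_tree T"
proof -
  \<comment> \<open>The rank \<open>depth v + side v\<close> is the distance to
    \<open>nd 0 0 0\<close>. An edge to a neighbour of smaller rank leaves through a port determined
    by \<open>v\<close>, so there is at most one such neighbour.\<close>
  have down: "u = nbr k v (if depth v = 0 then k else 0)"
    if e: "{v, u} \<in> edges T" "depth u + side u < depth v + side v" for u v
  proof -
    have "port T v u = (if depth v = 0 then k else 0)"
      using e by (auto simp: twin_edge_iff port_twin tdist_def tnodes_def split: if_splits)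
    then show ?thesis using nbr_port[OF _ _ _ e(1)] e(1) k L by (simp add: twin_edge_iff)
  qed
  have "\<not> cycle T vs" for vs
  proof (rule acyclic_by_rank[where rank = "\<lambda>v. depth v + side v"])
    show "depth u + side u \<noteq> depth w + side w" if "{u, w} \<in> edges T" for u w
      using that by (auto simp: twin_edge_iff tdist_def tnodes_def split: if_splits)
    show "u = w" if "{v, u} \<in> edges T" "{v, w} \<in> edges T"
      "depth u + side u < depth v + side v" "depth w + side w < depth v + side v" for v u w
      using down that by metis
  qed
  moreover have "e \<subseteq> V \<and> card e = 2" if e: "e \<in> edges T" for e
  proof -
    obtain u w where uw: "e = {u, w}" "u \<in> V" "w \<in> V" "tdist u w = 1"
      using e by (simp add: twin_def) blast
    then have "u \<noteq> w" by (auto simp: tdist_def)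
    then show ?thesis using uw by auto
  qed
  moreover have "V \<noteq> {}" using centre_in[of 0] by auto
  ultimately show ?thesis
    unfolding pn_tree_def using finite_nodes connected bij_port degree_twin by simp
qed

section \<open>Crossing the edge between the centres\<close>

text \<open>The port \<open>k\<close> between the centres occurs nowhere else, so it reveals whether a simple path
  changes sides.\<close>

lemma crossing_port: "{u, w} \<in> edges T \<Longrightarrow> side u \<noteq> side w \<longleftrightarrow> port T u w = k"
  using k by (auto simp: twin_edge_iff port_twin tdist_def tnodes_def split: if_splits)

text \<open>Nodes of different sides are at distance \<open>1\<close> only if both have depth
  \<open>0\<close>.\<close>

lemma crossing_centres:
  assumes "{u, w} \<in> edges T" "side u \<noteq> side w" "s < 2"
  shows "nd s 0 0 = u \<or> nd s 0 0 = w"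
  using assms by (auto simp: twin_edge_iff tdist_def tnodes_def nd_eq_iff less_2_cases_iff)

text \<open>Every crossing visits both centres, so a simple path crosses at most once and cannot
  come back.\<close>

lemma side_last:
  assumes "walk T vs" "distinct vs"
  shows "side (last vs) = side (hd vs) \<longleftrightarrow>
    \<not> (\<exists>i. Suc i < length vs \<and> side (vs ! i) \<noteq> side (vs ! Suc i))"
  using assms
proof (induction vs rule: induct_list012)
  case 1
  then show ?case by (simp add: walk_def)
next
  case (2 x)
  then show ?case by simp
next
  case (3 x y zs)
  let ?cross = "\<lambda>vs. \<exists>i. Suc i < length vs \<and> side (vs ! i) \<noteq> side (vs ! Suc i)"
  have w: "walk T (y # zs)" "{x, y} \<in> edges T" using 3(3) by (auto simp: walk_def)
  have IH: "side (last (y # zs)) = side y \<longleftrightarrow> \<not> ?cross (y # zs)"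
    using 3(2)[OF w(1)] 3(4) by simp
  have split: "?cross (x # y # zs) \<longleftrightarrow> side x \<noteq> side y \<or> ?cross (y # zs)"
  proof -
    have "(\<exists>i. P i) \<longleftrightarrow> P 0 \<or> (\<exists>i. P (Suc i))" for P :: "nat \<Rightarrow> bool"
      by (metis not0_implies_Suc)
    from this[of "\<lambda>i. Suc i < length (x # y # zs) \<and> _ i"] show ?thesis by simp
  qed
  show ?case
  proof (cases "side x = side y")
    case True
    then show ?thesis using IH split by simp
  next
    case False
    \<comment> \<open>The first edge crosses, so \<open>x\<close> is a centre, and a second crossing
      would visit it again.\<close>
    have "\<not> ?cross (y # zs)"
    proof
      assume "?cross (y # zs)"
      then obtain i where i: "Suc i < length (y # zs)"
        "side ((y # zs) ! i) \<noteq> side ((y # zs) ! Suc i)" by blast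
      have e: "{(y # zs) ! i, (y # zs) ! Suc i} \<in> edges T" using w(1) i(1) by (simp add: walk_def)
      have "x = nd (side x) 0 0" "side x < 2"
        using w(2) False by (auto simp: twin_edge_iff tdist_def tnodes_def nd_eq_iff)
      then have "x = (y # zs) ! i \<or> x = (y # zs) ! Suc i"
        using crossing_centres[OF e i(2), of "side x"] by simp
      then have "x \<in> set (y # zs)" using i(1) by (metis Suc_lessD nth_mem)
      then show False using 3(4) by simp
    qed
    then show ?thesis using IH split False by auto
  qed
qed

text \<open>Combines \<open>crossing_port\<close> with \<open>side_last\<close>. The output sequence
  alone thus reveals whether the leader is on the side of the node.\<close>

lemma side_of_leader:
  assumes f: "follows_ports T vs ps" and d: "distinct vs"
  shows "side (last vs) = side (hd vs) \<longleftrightarrow> k \<notin> set ps"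
proof -
  have w: "walk T vs" and len: "length vs = Suc (length ps)"
    and p: "\<And>i. i < length ps \<Longrightarrow> port T (vs ! i) (vs ! Suc i) = ps ! i"
    using f by (auto simp: follows_ports_def)
  have "side (vs ! i) \<noteq> side (vs ! Suc i) \<longleftrightarrow> ps ! i = k" if "i < length ps" for i
    using crossing_port[of "vs ! i" "vs ! Suc i"] w len p that by (simp add: walk_def)
  then show ?thesis using side_last[OF w d] len by (auto simp: in_set_conv_nth)
qed

section \<open>Feasibility of leader election\<close>

text \<open>The leader is the centre \<open>nd 0 0 0\<close>: port \<open>0\<close> leads to the
  node's own centre, and from side \<open>1\<close> port \<open>k\<close> leads across.\<close>

definition to_leader :: "nat \<Rightarrow> nat list" where
  "to_leader v = replicate (depth v) 0 @ (if side v = 0 then [] else [k])"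

lemma follows_ports_Cons:
  assumes "follows_ports T vs ps" "{v, hd vs} \<in> edges T" "port T v (hd vs) = p"
  shows "follows_ports T (v # vs) (p # ps)"
  using assms
  by (auto simp: follows_ports_def walk_def nth_Cons hd_conv_nth twin_edge_iff split: nat.splits)

lemma leader_election_to_leader: "leader_election T to_leader"
proof -
  \<comment> \<open>The bound on the depths ensures that a deeper node prepended to the path is
    new.\<close>
  have "\<exists>vs. follows_ports T vs (to_leader v) \<and> hd vs = v \<and> distinct vs \<and> last vs = nd 0 0 0 \<and>
      (\<forall>w\<in>set vs. depth w \<le> depth v)" if "v \<in> V" for v
    using that
  proof (induction "depth v" arbitrary: v)
    case 0
    then have v: "v = nd (side v) 0 0" "side v < 2" by (auto simp: tnodes_def nd_eq_iff)
    have b: "follows_ports T [nd 0 0 0] []"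
      using centre_in[of 0] by (simp add: follows_ports_def walk_def)
    show ?case
    proof (cases "side v = 0")
      case True
      then show ?thesis using v b by (intro exI[of _ "[v]"]) (auto simp: to_leader_def 0(1)[symmetric])
    next
      case False
      then have v1: "v = nd 1 0 0" using v by (simp add: less_2_cases_iff)
      have "follows_ports T [v, nd 0 0 0] [k]"
        using b by (rule follows_ports_Cons)
          (use centre_in[of 0] centre_in[of 1] in \<open>auto simp: v1 twin_edge_iff tdist_def port_twin\<close>)
      then show ?thesis
        by (intro exI[of _ "[v, nd 0 0 0]"]) (auto simp: v1 to_leader_def nd_eq_iff)
    qed
  next
    case (Suc d)
    define w where "w = nbr k v 0"
    have e: "{v, w} \<in> edges T" "port T v w = 0"
      using Suc k L unfolding w_def by (intro nbr_edge port_nbr; simp add: tdeg_def)+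
    have w: "w \<in> V" "d = depth w" "to_leader v = 0 # to_leader w"
      using e(1) Suc(2)[symmetric] by (auto simp: twin_edge_iff w_def nbr_def to_leader_def)
    obtain vs where vs: "follows_ports T vs (to_leader w)" "hd vs = w" "distinct vs"
      "last vs = nd 0 0 0" "\<forall>x\<in>set vs. depth x \<le> depth w"
      using Suc(1)[OF w(2,1)] by blast
    have "v \<notin> set vs" "vs \<noteq> []"
      using vs(1,5) w(2) Suc(2) by (auto simp: follows_ports_def)
    then show ?case
      using vs w Suc(2) e follows_ports_Cons[OF vs(1), of v 0]
      by (intro exI[of _ "v # vs"]) auto
  qed
  then show ?thesis
    unfolding leader_election_def using centre_in[of 0] by (intro bexI[of _ "nd 0 0 0"]) auto
qed

text \<open>Within radius \<open>r\<close> a node sees its own branch from the centre to the end. An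
  isomorphism preserves degrees, so it takes the centre to a centre; the ports then force it along
  the branch of the same number, and the degree at the end shows that the lengths agree. By
  \<open>ne\<close> the side is the same, so the node is mapped to itself.\<close>

lemma view_inj:
  assumes u: "u \<in> V" and v: "v \<in> V" and r: "\<And>s i. s < 2 \<Longrightarrow> i < k \<Longrightarrow> L s i \<le> r"
    and ne: "\<And>i. i < k \<Longrightarrow> L 0 i \<noteq> L 1 i"
    and eq: "view T u r = view T v r"
  shows "u = v"
proof -
  define U where "U = {w \<in> V. tdist u w \<le> r}"
  define W where "W = {w \<in> V. tdist v w \<le> r}"
  have lu: "local_view T u r = \<lparr>nodes = U, edges = {e \<in> edges T. e \<subseteq> U}, port = port T, vroot = u,
      bdeg = (\<lambda>w. if w \<in> U \<and> gdist T u w = r then Some (degree T w) else None)\<rparr>"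
    using u gdist_twin by (simp add: local_view_def Let_def U_def cong: conj_cong)
  have lv: "local_view T v r = \<lparr>nodes = W, edges = {e \<in> edges T. e \<subseteq> W}, port = port T, vroot = v,
      bdeg = (\<lambda>w. if w \<in> W \<and> gdist T v w = r then Some (degree T w) else None)\<rparr>"
    using v gdist_twin by (simp add: local_view_def Let_def W_def cong: conj_cong)
  have "view_iso (local_view T u r) (local_view T v r)"
    using eq u view_eq_iff[of u T] by simp
  then obtain f where f: "bij_betw f U W" and fu: "f u = v"
    and fe: "\<And>x y. x \<in> U \<Longrightarrow> y \<in> U \<Longrightarrow> {x, y} \<in> edges T \<and> {x, y} \<subseteq> U \<longleftrightarrow> {f x, f y} \<in> edges T \<and> {f x, f y} \<subseteq> W"
    and fp: "\<And>x y. x \<in> U \<Longrightarrow> y \<in> U \<Longrightarrow> {x, y} \<in> edges T \<Longrightarrow> port T x y = port T (f x) (f y)"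
    and fb: "\<And>x. x \<in> U \<Longrightarrow> (if x \<in> U \<and> gdist T u x = r then Some (degree T x) else None) =
        (if f x \<in> W \<and> gdist T v (f x) = r then Some (degree T (f x)) else None)"
    unfolding view_iso_def lu lv by simp blast
  have fW: "f x \<in> W" if "x \<in> U" for x using f that by (auto simp: bij_betw_def)
  have fE: "{x, y} \<in> edges T \<longleftrightarrow> {f x, f y} \<in> edges T" if "x \<in> U" "y \<in> U" for x y
    using fe[OF that] fW that by simp
  have UV: "U \<subseteq> V" "W \<subseteq> V" by (auto simp: U_def W_def)
  \<comment> \<open>On the sphere of radius \<open>r\<close> the degree is recorded in
    \<open>bdeg\<close>; inside it, all neighbours lie in the view and can be counted there.\<close>
  have deg: "tdeg k L (f x) = tdeg k L x" if x: "x \<in> U" for x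
  proof -
    have xV: "x \<in> V" "f x \<in> V" using x fW UV by auto
    have b: "(if tdist u x = r then Some (degree T x) else None) =
        (if tdist v (f x) = r then Some (degree T (f x)) else None)"
      using fb[OF x] x fW[OF x] gdist_twin[OF u xV(1)] gdist_twin[OF v xV(2)] by simp
    have "degree T (f x) = degree T x"
    proof (cases "tdist u x = r")
      case True
      then show ?thesis using b by (simp split: if_splits)
    next
      case False
      then have lt: "tdist u x < r" "tdist v (f x) < r"
        using b x fW[OF x] by (auto simp: U_def W_def split: if_splits)
      have nU: "y \<in> U" if "{x, y} \<in> edges T" for y
        using that tdist_triangle[of u y x] lt by (auto simp: U_def twin_edge_iff)
      have nW: "y \<in> W" if "{f x, y} \<in> edges T" for y
        using that tdist_triangle[of v y "f x"] lt by (auto simp: W_def twin_edge_iff)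
      have "neighbours T (f x) = f ` neighbours T x"
      proof (intro set_eqI iffI)
        fix y assume y: "y \<in> neighbours T (f x)"
        then obtain z where "z \<in> U" "y = f z"
          using nW f by (auto simp: neighbours_def bij_betw_def)
        then show "y \<in> f ` neighbours T x" using y fE[OF x] by (auto simp: neighbours_def)
      next
        fix y assume "y \<in> f ` neighbours T x"
        then show "y \<in> neighbours T (f x)" using fE[OF x] nU by (auto simp: neighbours_def)
      qed
      moreover have "inj_on f (neighbours T x)"
        using f nU by (auto simp: neighbours_def bij_betw_def intro: inj_on_subset)
      ultimately show ?thesis by (simp add: degree_def card_image)
    qed
    then show ?thesis using xV degree_twin by simp
  qed
  define s i where "s = side u" and "i = branch u"
  have si: "s < 2" "i < k" "depth u \<le> L s i" "depth u = 0 \<longrightarrow> i = 0"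
    using u by (auto simp: s_def i_def tnodes_def)
  define path where "path t e = nd t (if e = 0 then 0 else i) e" for t e
  have pU: "path s e \<in> U" if "e \<le> L s i" for e
    using that si r[OF si(1,2)] k
    by (auto simp: U_def path_def tnodes_def tdist_def s_def[symmetric] i_def[symmetric])
  define t where "t = side (f (path s 0))"
  \<comment> \<open>As \<open>k\<close> is at least \<open>2\<close>, only centres have this
    degree.\<close>
  have "tdeg k L (f (path s 0)) = Suc k"
    using deg[OF pU[of 0]] by (simp add: path_def tdeg_def)
  then have f0: "f (path s 0) = path t 0" and t: "t < 2"
    using k fW[OF pU[of 0]]
    by (auto simp: t_def path_def tdeg_def nd_eq_iff W_def tnodes_def split: if_splits)
  have fpath: "f (path s e) = path t e" if "e \<le> L s i" for e
    using that
  proof (induction e)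
    case 0
    show ?case by (rule f0)
  next
    case (Suc e)
    have U: "path s e \<in> U" "path s (Suc e) \<in> U" using pU Suc(2) by auto
    have E: "{path s e, path s (Suc e)} \<in> edges T"
      using U UV by (auto simp: twin_edge_iff tdist_def path_def)
    have fe: "f (path s e) = path t e" using Suc by simp
    have E': "{path t e, f (path s (Suc e))} \<in> edges T"
      using fE[OF U] E unfolding fe by simp
    have p: "port T (path t e) (f (path s (Suc e))) = (if e = 0 then i else 1)"
    proof -
      have "port T (path s e) (path s (Suc e)) = (if e = 0 then i else 1)"
        by (simp add: port_twin path_def)
      then show ?thesis using fp[OF U E] unfolding fe by simp
    qed
    have "f (path s (Suc e)) = nbr k (path t e) (if e = 0 then i else 1)"
      using nbr_port[OF _ _ _ E'] L k E' unfolding p by (simp add: twin_edge_iff)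
    then show ?case using si by (auto simp: nbr_def path_def)
  qed
  have l: "1 \<le> L s i" using L si by simp
  \<comment> \<open>A branch end has degree \<open>1\<close>, so the branch followed by the image
    must end at the same depth.\<close>
  have "tdeg k L (path t (L s i)) = 1"
    using deg[OF pU[of "L s i"]] fpath[of "L s i"] l by (simp add: path_def tdeg_def)
  moreover have "tdeg k L (path t (L s i)) = 2" if "L s i \<noteq> L t i"
    using that l by (simp add: path_def tdeg_def)
  ultimately have "L t i = L s i" by fastforce
  then have "t = s" using t si(1) ne[OF si(2)] unfolding less_2_cases_iff by fastforce
  moreover have "u = path s (depth u)"
    using si by (auto simp: path_def nd_eq_iff s_def i_def)
  ultimately show "u = v" using fpath si fu by metis
qed

text \<open>At radius \<open>r\<close> distinct nodes have distinct views, so every election, here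
  \<open>to_leader\<close>, is determined by the views.\<close>

lemma xi_twin:
  assumes "\<And>s i. s < 2 \<Longrightarrow> i < k \<Longrightarrow> L s i \<le> r" and "\<And>i. i < k \<Longrightarrow> L 0 i \<noteq> L 1 i" and "r \<le> t"
  shows "xi T \<le> enat t"
proof -
  have "feasible_in T r"
    unfolding feasible_in_def using leader_election_to_leader view_inj[OF _ _ assms(1,2)]
    by (metis nodes_twin)
  then have "xi T \<le> enat r" unfolding xi_def by (auto intro: Inf_lower)
  then show ?thesis using assms(3) by (metis enat_ord_simps(1) order_trans)
qed

end

section \<open>Indistinguishable branch ends\<close>

text \<open>
  \<open>\<sigma>\<close> is the identity or swaps the sides. By the assumption on \<open>r\<close> all branch ends but the root of
  the view are out of sight.
\<close>

lemma view_twin_eq: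
  assumes tw: "twin_tree k L" "twin_tree k L'"
    and \<sigma>: "\<And>t. t < 2 \<Longrightarrow> \<sigma> t < 2 \<and> \<sigma> (\<sigma> t) = t"
    and si: "s < 2" "i < k" "L' (\<sigma> s) i = L s i"
    and r: "\<And>t j. t < 2 \<Longrightarrow> j < k \<Longrightarrow> (t, j) \<noteq> (s, i) \<Longrightarrow> r < L s i + L t j \<and> r < L s i + L' (\<sigma> t) j"
  shows "view (twin k L) (nd s i (L s i)) r = view (twin k L') (nd (\<sigma> s) i (L s i)) r"
proof -
  interpret T: twin_tree k L by fact
  interpret T': twin_tree k L' by fact
  \<comment> \<open>The map applies \<open>\<sigma>\<close> to the side. It is its own inverse on
    the nodes, so it serves both directions.\<close>
  define f where "f w = nd (\<sigma> (side w)) (branch w) (depth w)" for w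
  define x where "x = nd s i (L s i)"
  define y where "y = nd (\<sigma> s) i (L s i)"
  have xy: "x \<in> tnodes k L" "y \<in> tnodes k L'"
    using si \<sigma>[of s] T.L[of s i] by (auto simp: x_def y_def tnodes_def)
  have \<sigma>_eq: "\<sigma> t = \<sigma> t' \<longleftrightarrow> t = t'" if "t < 2" "t' < 2" for t t'
    using \<sigma> that by metis
  have fd: "tdist (f u) (f w) = tdist u w" if "side u < 2" "side w < 2" for u w
    using \<sigma>_eq[OF that] by (simp add: tdist_def f_def)
  have ff: "f (f w) = w" if "side w < 2" for w
    using \<sigma>[OF that] by (simp add: f_def)
  have fx: "f x = y" by (simp add: x_def y_def f_def)
  \<comment> \<open>Stated for arbitrary \<open>M\<close> and \<open>M'\<close>, to be used from
    \<open>L\<close> to \<open>L'\<close> and back. On all branches but that of the root, the ball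
    stays strictly before the end in both trees, so the degrees agree.\<close>
  have ball: "f w \<in> tnodes k M' \<and> tdeg k M' (f w) = tdeg k M w"
    if w: "w \<in> tnodes k M" "tdist (nd q i l) w \<le> r"
      and q: "q < 2" "M q i = l" "M' (\<sigma> q) i = l"
      and far: "\<And>t j. t < 2 \<Longrightarrow> j < k \<Longrightarrow> (t, j) \<noteq> (q, i) \<Longrightarrow> r < l + M t j \<and> r < l + M' (\<sigma> t) j"
    for w q l M M'
  proof -
    have b: "side w < 2" "branch w < k" "\<sigma> (side w) < 2" using w \<sigma> by (auto simp: tnodes_def)
    show ?thesis
    proof (cases "(side w, branch w) = (q, i)")
      case True
      then show ?thesis using w b q by (auto simp: f_def tnodes_def tdeg_def)
    next
      case False
      then have "l + depth w \<le> r" using w by (auto simp: tdist_def split: if_splits)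
      then have "depth w < M (side w) (branch w)" "depth w < M' (\<sigma> (side w)) (branch w)"
        using far[OF b(1,2) False] by auto
      then show ?thesis using w b by (auto simp: f_def tnodes_def tdeg_def)
    qed
  qed
  define U where "U = {w \<in> tnodes k L. tdist x w \<le> r}"
  define W where "W = {w \<in> tnodes k L'. tdist y w \<le> r}"
  have U2: "side w < 2" if "w \<in> U" for w using that by (simp add: U_def tnodes_def)
  have W2: "side w < 2" if "w \<in> W" for w using that by (simp add: W_def tnodes_def)
  have x2: "side x < 2" "side y < 2" using si \<sigma>[of s] by (auto simp: x_def y_def)
  have UW: "f w \<in> W \<and> tdeg k L' (f w) = tdeg k L w" if "w \<in> U" for w
  proof -
    have "f w \<in> tnodes k L' \<and> tdeg k L' (f w) = tdeg k L w"
      by (rule ball[of w L s "L s i"]) (use that si r in \<open>auto simp: U_def x_def\<close>)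
    moreover have "tdist y (f w) \<le> r"
      using fd[OF x2(1) U2[OF that]] fx that by (simp add: U_def)
    ultimately show ?thesis by (simp add: W_def)
  qed
  have WU: "f w \<in> U" if "w \<in> W" for w
  proof -
    have "r < L s i + L' t j \<and> r < L s i + L (\<sigma> t) j" if "t < 2" "j < k" "(t, j) \<noteq> (\<sigma> s, i)" for t j
    proof -
      have "(\<sigma> t, j) \<noteq> (s, i)" using \<sigma>[of t] that by auto
      then show ?thesis using r[of "\<sigma> t" j] \<sigma>[of t] that by auto
    qed
    then have "f w \<in> tnodes k L"
      using that si \<sigma>[of s] by (intro ball[of w L' "\<sigma> s" "L s i", THEN conjunct1]) (auto simp: W_def y_def)
    then show ?thesis using that fd[of y w] fx ff[of x] x2 W2 by (auto simp: U_def W_def)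
  qed
  have bij: "bij_betw f U W"
    by (rule bij_betw_byWitness[where f' = f]) (use ff UW WU U2 W2 in auto)
  have UV: "U \<subseteq> tnodes k L" "W \<subseteq> tnodes k L'" by (auto simp: U_def W_def)
  have lx: "local_view (twin k L) x r =
      \<lparr>nodes = U, edges = {e \<in> edges (twin k L). e \<subseteq> U}, port = port (twin k L), vroot = x,
      bdeg = (\<lambda>w. if w \<in> U \<and> gdist (twin k L) x w = r then Some (degree (twin k L) w) else None)\<rparr>"
    using xy T.gdist_twin by (simp add: local_view_def Let_def U_def cong: conj_cong)
  have ly: "local_view (twin k L') y r =
      \<lparr>nodes = W, edges = {e \<in> edges (twin k L'). e \<subseteq> W}, port = port (twin k L'), vroot = y,
      bdeg = (\<lambda>w. if w \<in> W \<and> gdist (twin k L') y w = r then Some (degree (twin k L') w) else None)\<rparr>"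
    using xy T'.gdist_twin by (simp add: local_view_def Let_def W_def cong: conj_cong)
  have E: "{u, w} \<in> edges (twin k L) \<longleftrightarrow> {f u, f w} \<in> edges (twin k L')" if "u \<in> U" "w \<in> U" for u w
    using that UW UV fd[OF U2 U2, of u w] by (auto simp: twin_edge_iff)
  have P: "port (twin k L) u w = port (twin k L') (f u) (f w)" if "u \<in> U" "w \<in> U" for u w
    using \<sigma>_eq[OF U2 U2, of w u] that by (simp add: port_twin f_def)
  have B: "(if gdist (twin k L) x w = r then Some (degree (twin k L) w) else None) =
      (if gdist (twin k L') y (f w) = r then Some (degree (twin k L') (f w)) else None)"
    if "w \<in> U" for w
  proof -
    have w: "w \<in> tnodes k L" "f w \<in> tnodes k L'" "tdeg k L' (f w) = tdeg k L w" "side w < 2"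
      using UW[OF that] that UV U2 by auto
    then show ?thesis
      using T.gdist_twin[OF xy(1) w(1)] T'.gdist_twin[OF xy(2) w(2)] fd[of x w] x2(1)
        T.degree_twin[OF w(1)] T'.degree_twin[OF w(2)]
      by (simp add: fx)
  qed
  have "view_iso (local_view (twin k L) x r) (local_view (twin k L') y r)"
    unfolding view_iso_def lx ly
    by (rule exI[of _ f]) (use bij fx E P B UW in auto)
  then show ?thesis using view_eq_iff[of x "twin k L"] xy by (simp add: x_def y_def)
qed

section \<open>The family of trees indexed by sets of bits\<close>

text \<open>The bit \<open>i \<in> b\<close> decides on which side branch \<open>i\<close> is the longer one.\<close>

definition len :: "nat \<Rightarrow> nat set \<Rightarrow> nat \<Rightarrow> nat \<Rightarrow> nat" where
  "len h b s i = (if i = 0 then h - s else if s = 0 \<longleftrightarrow> i \<in> b then h - 1 else h - 2)"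

lemma len_bounds:
  assumes "s < 2"
  shows "h - 2 \<le> len h b s i" "len h b s i \<le> h" "(s, i) \<noteq> (0, 0) \<Longrightarrow> len h b s i \<le> h - 1"
  using assms by (auto simp: len_def)

lemma twin_tree_len: "2 \<le> k \<Longrightarrow> 4 \<le> h \<Longrightarrow> twin_tree k (len h b)"
  by unfold_locales (auto simp: len_def)

text \<open>Only branch \<open>0\<close> of side \<open>0\<close> reaches depth \<open>h\<close>, so
  depths on different sides add up to at most \<open>2 * h - 1\<close>, and the crossing edge adds
  \<open>1\<close>. The ends of the two branches \<open>0\<close> attain this.\<close>

lemma diam_len:
  assumes k: "2 \<le> k" and h: "4 \<le> h"
  shows "diam (twin k (len h b)) = 2 * h"
proof -
  interpret twin_tree k "len h b" using assms by (rule twin_tree_len)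
  let ?S = "{gdist T u v | u v. u \<in> nodes T \<and> v \<in> nodes T}"
  have dep: "depth v \<le> h \<and> (side v = 0 \<and> branch v = 0 \<or> depth v \<le> h - 1)" if "v \<in> V" for v
    using that len_bounds(2,3)[where s = "side v" and i = "branch v" and h = h and b = b]
    by (cases "(side v, branch v) = (0, 0)") (auto simp: tnodes_def)
  have le: "gdist T u v \<le> 2 * h" if uv: "u \<in> V" "v \<in> V" for u v
    using dep[OF uv(1)] dep[OF uv(2)] h unfolding gdist_twin[OF uv] tdist_def by auto
  have ends: "nd 0 0 h \<in> V" "nd 1 0 (h - 1) \<in> V" using k h by (auto simp: tnodes_def len_def)
  have "gdist T (nd 0 0 h) (nd 1 0 (h - 1)) = 2 * h"
    using h unfolding gdist_twin[OF ends] tdist_def by simp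
  then have "2 * h \<in> ?S" using ends by (metis (mono_tags, lifting) mem_Collect_eq nodes_twin)
  moreover have "?S = (\<lambda>(u, v). gdist T u v) ` (V \<times> V)" by auto
  then have "finite ?S" using finite_nodes by simp
  ultimately show ?thesis unfolding diam_def using le by (intro Max_eqI) auto
qed

lemma card_len:
  assumes k: "2 \<le> k" and h: "4 \<le> h"
  shows "2 * (k * (h - 2)) \<le> card (tnodes k (len h b))"
    and "card (tnodes k (len h b)) \<le> 2 * (k * Suc h)"
proof -
  interpret twin_tree k "len h b" using assms by (rule twin_tree_len)
  let ?f = "\<lambda>(s, i, d). nd s i d"
  have inj: "inj_on ?f X" for X by (auto simp: inj_on_def nd_eq_iff)
  \<comment> \<open>Every branch has nodes of depths \<open>1\<close> to \<open>h - 2\<close>. Depth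
    \<open>0\<close> is left out, since a centre is not repeated for each branch.\<close>
  have "?f ` ({..<2} \<times> {..<k} \<times> {1..h - 2}) \<subseteq> V"
    by (auto simp: tnodes_def intro: order_trans[OF _ len_bounds(1)])
  from card_mono[OF finite_nodes this] show "2 * (k * (h - 2)) \<le> card V"
    by (simp add: card_image[OF inj])
  have "V \<subseteq> ?f ` ({..<2} \<times> {..<k} \<times> {..h})"
  proof
    fix v assume "v \<in> V"
    then show "v \<in> ?f ` ({..<2} \<times> {..<k} \<times> {..h})"
      using len_bounds(2)[of "side v" h b "branch v"]
      by (intro image_eqI[of _ _ "(side v, branch v, depth v)"]) (auto simp: tnodes_def)
  qed
  from card_mono[OF _ this] show "card V \<le> 2 * (k * Suc h)"
    by (simp add: card_image[OF inj])
qed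

lemma xi_len:
  assumes "2 \<le> k" "4 \<le> h" "h \<le> t"
  shows "xi (twin k (len h b)) \<le> enat t"
proof -
  interpret twin_tree k "len h b" using assms(1,2) by (rule twin_tree_len)
  show ?thesis
    using assms(2,3) by (intro xi_twin[where r = h]) (auto simp: len_def)
qed

section \<open>The lower bound on advice\<close>

text \<open>Here \<open>c\<close> is the side of the leader.\<close>

lemma (in twin_tree) leader_side:
  assumes "leader_election T P"
  obtains c where "c < 2" "\<And>v. v \<in> V \<Longrightarrow> side v = c \<longleftrightarrow> k \<notin> set (P v)"
proof -
  obtain l where l: "l \<in> V" "\<And>v. v \<in> V \<Longrightarrow> \<exists>vs. follows_ports T vs (P v) \<and> hd vs = v \<and>
      distinct vs \<and> last vs = l"
    using assms unfolding leader_election_def by auto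
  show thesis
  proof (rule that[of "side l"])
    show "side l < 2" using l by (simp add: tnodes_def)
    show "side v = side l \<longleftrightarrow> k \<notin> set (P v)" if "v \<in> V" for v
      using l(2)[OF that] side_of_leader by metis
  qed
qed

text \<open>
  The end of the longest branch forces the leader to the same side in both trees. The end of the
  longer branch \<open>j\<close> has the same output in both trees, but lies on opposite sides.
\<close>

lemma advice_inj:
  assumes k: "2 \<le> k" and h: "4 \<le> h" and t: "t \<le> 2 * h - 4"
    and b: "b \<subseteq> {1..<k}" "b' \<subseteq> {1..<k}"
    and works: "works_in_time alg A t \<T>" "twin k (len h b) \<in> \<T>" "twin k (len h b') \<in> \<T>"
    and adv: "A (twin k (len h b)) = A (twin k (len h b'))"
  shows "b = b'"
proof (rule ccontr)
  assume "b \<noteq> b'"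
  then obtain j where j: "j \<in> b \<longleftrightarrow> j \<notin> b'" "1 \<le> j" "j < k" using b by fastforce
  let ?L = "len h b" and ?L' = "len h b'"
  interpret T: twin_tree k ?L using k h by (rule twin_tree_len)
  interpret T': twin_tree k ?L' using k h by (rule twin_tree_len)
  define P where "P = node_output alg (A T.T) T.T"
  define P' where "P' = node_output alg (A T.T) T'.T"
  have halts: "\<exists>r\<le>t. alg (view T.T v r) (A T.T) \<noteq> None" if "v \<in> T.V" for v
    using works that by (auto simp: works_in_time_def)
  have le: "leader_election T.T P" "leader_election T'.T P'"
    using works adv by (auto simp: works_in_time_def P_def P'_def)
  obtain c where c: "c < 2" "\<And>v. v \<in> T.V \<Longrightarrow> side v = c \<longleftrightarrow> k \<notin> set (P v)"
    using T.leader_side[OF le(1)] by blast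
  obtain c' where c': "c' < 2" "\<And>v. v \<in> T'.V \<Longrightarrow> side v = c' \<longleftrightarrow> k \<notin> set (P' v)"
    using T'.leader_side[OF le(2)] by blast
  \<comment> \<open>A length of at least \<open>h - 1\<close> and that of any other branch, at least
    \<open>h - 2\<close>, add up to at least \<open>2 * h - 3\<close>, which exceeds every round up
    to \<open>t\<close>. Below, \<open>\<sigma>\<close> is the identity for the longest branch and
    the swap for branch \<open>j\<close>.\<close>
  have same: "P (nd s i (?L s i)) = P' (nd (\<sigma> s) i (?L s i))"
    if \<sigma>: "\<And>t. t < 2 \<Longrightarrow> \<sigma> t < 2 \<and> \<sigma> (\<sigma> t) = t"
      and s: "s < 2" "i < k" "?L' (\<sigma> s) i = ?L s i" "h - 1 \<le> ?L s i" "i = 0 \<longrightarrow> s = 0" for \<sigma> s i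
    unfolding P_def P'_def
  proof (rule node_output_cong)
    show "\<exists>r\<le>t. alg (view T.T (nd s i (?L s i)) r) (A T.T) \<noteq> None"
      using s T.L[of s i] by (intro halts) (auto simp: tnodes_def)
    fix r assume "r \<le> t"
    show "view T.T (nd s i (?L s i)) r = view T'.T (nd (\<sigma> s) i (?L s i)) r"
    proof (rule view_twin_eq)
      fix q i' :: nat assume "q < 2"
      then show "r < ?L s i + ?L q i' \<and> r < ?L s i + ?L' (\<sigma> q) i'"
        using len_bounds(1)[of q h b i'] len_bounds(1)[of "\<sigma> q" h b' i'] \<sigma>[of q] s(4) t h \<open>r \<le> t\<close>
        by linarith
    qed (use T.twin_tree_axioms T'.twin_tree_axioms \<sigma> s in auto)
  qed
  have "P (nd 0 0 h) = P' (nd 0 0 h)"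
    using same[of "\<lambda>t. t" 0 0] k by (simp add: len_def)
  moreover have "nd 0 0 h \<in> T.V" "nd 0 0 h \<in> T'.V"
    using k by (auto simp: tnodes_def len_def)
  ultimately have "c = c'" using c(1) c'(1) c(2)[of "nd 0 0 h"] c'(2)[of "nd 0 0 h"]
    by (auto simp: less_2_cases_iff)
  \<comment> \<open>The side on which branch \<open>j\<close> has length \<open>h - 1\<close> in the
    first tree. As bit \<open>j\<close> differs, it is \<open>1 - s\<close> in the second
    tree.\<close>
  define s :: nat where "s = (if j \<in> b then 0 else 1)"
  have s: "s < 2" "?L s j = h - 1" "?L' (1 - s) j = h - 1"
    using j by (auto simp: s_def len_def)
  have "P (nd s j (h - 1)) = P' (nd (1 - s) j (h - 1))"
    using same[of "\<lambda>t. 1 - t" s j] s j by simp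
  moreover have "nd s j (h - 1) \<in> T.V" "nd (1 - s) j (h - 1) \<in> T'.V"
    using s j h by (auto simp: tnodes_def)
  ultimately have "s = c \<longleftrightarrow> 1 - s = c'"
    using c(2)[of "nd s j (h - 1)"] c'(2)[of "nd (1 - s) j (h - 1)"] by simp
  then show False using \<open>c = c'\<close> s(1) c(1) by (auto simp: less_2_cases_iff)
qed

theorem theorem5p3:
  shows "\<exists>a b c :: real. 0 < a \<and> 0 < b \<and> 0 < c \<and>
    (\<forall>n D \<tau> :: nat. 8 \<le> D \<longrightarrow> D < n \<longrightarrow> even D \<longrightarrow> D div 2 \<le> \<tau> \<longrightarrow> \<tau> \<le> D - 4 \<longrightarrow>
      (\<exists>\<T> :: nat pgraph set.
        (\<forall>T\<in>\<T>. pn_tree T \<and>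
           a * real n \<le> real (card (nodes T)) \<and> real (card (nodes T)) \<le> b * real n \<and>
           diam T = D \<and> xi T \<le> enat \<tau>) \<and>
        (\<forall>(alg :: nat algorithm) (A :: nat adviser). works_in_time alg A \<tau> \<T> \<longrightarrow>
           ereal (c * (real n / real D)) \<le> advice_size A \<T>)))"
proof (rule exI[of _ "1/2"], rule exI[of _ 8], rule exI[of _ 1], intro conjI allI impI)
  fix n D \<tau> :: nat
  assume D: "8 \<le> D" "D < n" "even D" "D div 2 \<le> \<tau>" "\<tau> \<le> D - 4"
  define h where "h = D div 2"
  \<comment> \<open>There are \<open>k - 1 = n div D + 4\<close> free bits, at least
    \<open>n / D\<close>. Also \<open>k \<le> 6 * (n div D)\<close>, so \<open>k * D\<close> lies
    between \<open>n\<close> and \<open>6 * n\<close>.\<close>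
  define k where "k = n div D + 5"
  define tree where "tree b = twin k (len h b)" for b
  define \<T> where "\<T> = tree ` Pow {1..<k}"
  have h: "4 \<le> h" "D = 2 * h" and k: "2 \<le> k" using D by (auto simp: h_def k_def)
  have nD: "n < Suc (n div D) * D" "n div D * D \<le> n"
    using D dividend_less_div_times[of D n] by (auto simp: algebra_simps)
  have size: "1/2 * real n \<le> real (card (nodes (tree b)))" "real (card (nodes (tree b))) \<le> 8 * real n"
    for b
  proof -
    \<comment> \<open>Since \<open>h\<close> is at least \<open>4\<close>, \<open>D = 2 * h\<close>
      is at most \<open>4 * (h - 2)\<close>.\<close>
    have "k * D \<le> k * (4 * (h - 2))" using h by (intro mult_left_mono) auto
    moreover have "Suc (n div D) * D \<le> k * D" by (intro mult_right_mono) (auto simp: k_def)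
    ultimately have "n \<le> k * (4 * (h - 2))" using nD(1) by linarith
    then have "n \<le> 2 * (2 * (k * (h - 2)))" by simp
    then have "n \<le> 2 * card (nodes (tree b))"
      using card_len(1)[OF k h(1), of b] by (simp add: tree_def)
    then show "1/2 * real n \<le> real (card (nodes (tree b)))" by linarith
    have "1 \<le> n div D" using D by (simp add: div_greater_zero_iff Suc_le_eq)
    then have "k * D \<le> 6 * (n div D) * D" by (intro mult_right_mono) (auto simp: k_def)
    then have "k * D \<le> 6 * n" using nD(2) unfolding mult.assoc by linarith
    \<comment> \<open>\<open>8 * Suc h \<le> 10 * h\<close> as \<open>h\<close> is at least
      \<open>4\<close>. The right side is at most \<open>30 * n\<close>, hence at most
      \<open>4 * (8 * n)\<close>.\<close>
    moreover have "4 * (2 * (k * Suc h)) \<le> 5 * (k * D)"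
      using mult_left_mono[of "8 * Suc h" "5 * D" k] h by (simp add: algebra_simps)
    ultimately have "2 * (k * Suc h) \<le> 8 * n" by linarith
    then have "card (nodes (tree b)) \<le> 8 * n"
      using card_len(2)[OF k h(1), of b] by (simp add: tree_def)
    then show "real (card (nodes (tree b))) \<le> 8 * real n" by linarith
  qed
  have "pn_tree (tree b)" "diam (tree b) = D" "xi (tree b) \<le> enat \<tau>" for b
    using twin_tree.pn_tree_twin[OF twin_tree_len[OF k h(1)]] diam_len[OF k h(1)]
      xi_len[OF k h(1)] D h by (auto simp: tree_def)
  then have good: "\<forall>T\<in>\<T>. pn_tree T \<and>
      1/2 * real n \<le> real (card (nodes T)) \<and> real (card (nodes T)) \<le> 8 * real n \<and>
      diam T = D \<and> xi T \<le> enat \<tau>"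
    using size by (auto simp: \<T>_def)
  have "ereal (1 * (real n / real D)) \<le> advice_size A \<T>" if "works_in_time alg A \<tau> \<T>" for alg A
  proof -
    \<comment> \<open>Injectivity of the composition gives two things: \<open>tree\<close> is
      injective, which counts \<open>\<T>\<close>, and \<open>A\<close> is injective on
      \<open>\<T>\<close>.\<close>
    have inj: "inj_on (A \<circ> tree) (Pow {1..<k})"
    proof (rule inj_onI)
      fix b b' assume b: "b \<in> Pow {1..<k}" "b' \<in> Pow {1..<k}" "(A \<circ> tree) b = (A \<circ> tree) b'"
      then have "tree b \<in> \<T>" "tree b' \<in> \<T>" by (auto simp: \<T>_def)
      then show "b = b'"
        using advice_inj[OF k h(1) _ _ _ that, of b b'] b D h by (auto simp: tree_def)
    qed
    have "real n / real D \<le> real (k - 1)"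
    proof -
      have "n \<le> (k - 1) * D"
        using nD(1) mult_right_mono[of "Suc (n div D)" "k - 1" D] by (simp add: k_def)
      then have "real n \<le> real (k - 1) * real D" by (metis of_nat_le_iff of_nat_mult)
      moreover have "0 < real D" using D by simp
      ultimately show ?thesis by (simp only: pos_divide_le_eq)
    qed
    also have "ereal (real (k - 1)) \<le> advice_size A \<T>"
    proof (rule advice_size_lower)
      show "inj_on A \<T>" using inj unfolding \<T>_def by (rule inj_on_imageI)
      have "card \<T> = card (Pow {1..<k})"
        using inj_on_imageI2[OF inj] unfolding \<T>_def by (rule card_image)
      then show "2 ^ (k - 1) \<le> card \<T>" by (simp add: card_Pow)
    qed (simp add: \<T>_def)
    finally show ?thesis by simp
  qed
  with good show "\<exists>\<T> :: nat pgraph set.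
        (\<forall>T\<in>\<T>. pn_tree T \<and>
           1/2 * real n \<le> real (card (nodes T)) \<and> real (card (nodes T)) \<le> 8 * real n \<and>
           diam T = D \<and> xi T \<le> enat \<tau>) \<and>
        (\<forall>(alg :: nat algorithm) (A :: nat adviser). works_in_time alg A \<tau> \<T> \<longrightarrow>
           ereal (1 * (real n / real D)) \<le> advice_size A \<T>)"
    by blast
qed simp_all

end
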